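(* Let $(X,r)$ be a left non-degenerate solution, $r(a,b)=(\sigma_a(b),\tau_b(a))$, and let $(X,\triangleright_r)$ be the left shelf associated to $r$. Then, for any $x\in X$, the binary operation $\bullet$ on $X$ defined by $$a\bullet b=\sigma_a(b)\triangleright_r(a\triangleright_r x)$$ makes $(X,\bullet)$ a Yang-Baxter algebra for $(X,r)$.
   Context: A solution $(X,r)$ is a set $X$ with a map $r:X\times X\to X\times X$ satisfying the braid identity $(r\times \mathrm{id}_X)(\mathrm{id}_X\times r)(r\times\mathrm{id}_X)=(\mathrm{id}_X\times r)(r\times\mathrm{id}_X)(\mathrm{id}_X\times r)$. Writing $r(a,b)=(\sigma_a(b),\tau_b(a))$, $r$ is left non-degenerate if every $\sigma_a$ is a bijection of $X$. The left shelf associated to $r$ is $(X,\triangleright_r)$ with $a\triangleright_r b:=\sigma_a\tau_{\sigma_b^{-1}(a)}(b)$. Given a solution $(X,r)$, a pair $(X,m)$ with $m:X\times X\to X$ an arbitrary binary operation is a Yang-Baxter algebra for $r$ if $m(x,y)=m(r(x,y))$ for all $x,y\in X$. *)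

theory Defs
  imports Main "HOL-Library.FuncSet"
begin

text \<open>
  All structures live on an explicit carrier set \<open>X\<close>; maps and operations are HOL functions
  that are only required to behave well on \<open>X\<close>.
\<close>

definition r_times_id :: "('a \<times> 'a \<Rightarrow> 'a \<times> 'a) \<Rightarrow> 'a \<times> 'a \<times> 'a \<Rightarrow> 'a \<times> 'a \<times> 'a" where
  "r_times_id r = (\<lambda>(a, b, c). (fst (r (a, b)), snd (r (a, b)), c))"

definition id_times_r :: "('a \<times> 'a \<Rightarrow> 'a \<times> 'a) \<Rightarrow> 'a \<times> 'a \<times> 'a \<Rightarrow> 'a \<times> 'a \<times> 'a" where
  "id_times_r r = map_prod id r"

definition solution :: "'a set \<Rightarrow> ('a \<times> 'a \<Rightarrow> 'a \<times> 'a) \<Rightarrow> bool" where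
  "solution X r \<longleftrightarrow>
     r \<in> X \<times> X \<rightarrow> X \<times> X \<and>
     (\<forall>t \<in> X \<times> X \<times> X.
        (r_times_id r \<circ> id_times_r r \<circ> r_times_id r) t =
        (id_times_r r \<circ> r_times_id r \<circ> id_times_r r) t)"

text \<open>Componentwise, \<open>r (a, b) = (sigma r a b, tau r b a)\<close>; note the argument order of \<open>tau\<close>.\<close>

definition sigma :: "('a \<times> 'a \<Rightarrow> 'a \<times> 'a) \<Rightarrow> 'a \<Rightarrow> 'a \<Rightarrow> 'a" where
  "sigma r a b = fst (r (a, b))"

definition tau :: "('a \<times> 'a \<Rightarrow> 'a \<times> 'a) \<Rightarrow> 'a \<Rightarrow> 'a \<Rightarrow> 'a" where
  "tau r b a = snd (r (a, b))"

definition left_nondegenerate :: "'a set \<Rightarrow> ('a \<times> 'a \<Rightarrow> 'a \<times> 'a) \<Rightarrow> bool" where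
  "left_nondegenerate X r \<longleftrightarrow> (\<forall>a \<in> X. bij_betw (sigma r a) X X)"

definition shelf_op :: "'a set \<Rightarrow> ('a \<times> 'a \<Rightarrow> 'a \<times> 'a) \<Rightarrow> 'a \<Rightarrow> 'a \<Rightarrow> 'a" where
  "shelf_op X r a b = sigma r a (tau r (inv_into X (sigma r b) a) b)"

definition yang_baxter_algebra ::
    "'a set \<Rightarrow> ('a \<times> 'a \<Rightarrow> 'a \<times> 'a) \<Rightarrow> ('a \<times> 'a \<Rightarrow> 'a) \<Rightarrow> bool" where
  "yang_baxter_algebra X r m \<longleftrightarrow>
     m \<in> X \<times> X \<rightarrow> X \<and> (\<forall>x \<in> X. \<forall>y \<in> X. m (x, y) = m (r (x, y)))"

end

theory Submission imports Defs begin

text \<open>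
  Write \<open>r (a, b) = (u, v)\<close> with \<open>u = \<sigma>\<^sub>a b\<close>. Then \<open>\<sigma>\<^sub>u v = u \<triangleright> a\<close>, because \<open>b = \<sigma>\<^sub>a\<^sup>-\<^sup>1 u\<close> and so
  \<open>v = \<tau>\<^sub>b a\<close> is exactly the element to which the definition of \<open>u \<triangleright> a\<close> applies \<open>\<sigma>\<^sub>u\<close>. Hence the
  invariance of \<open>\<bullet>\<close> under \<open>r\<close> is the equation
  \<open>u \<triangleright> (a \<triangleright> x) = (u \<triangleright> a) \<triangleright> (u \<triangleright> x)\<close>, an instance of left self-distributivity of \<open>\<triangleright>\<close>.

  Self-distributivity comes from transporting the braid identity along the bijection
  \<open>J (a, b, c) = (a, \<sigma>\<^sub>a b, \<sigma>\<^sub>a (\<sigma>\<^sub>b c))\<close> of \<open>X \<times> X \<times> X\<close>. Under \<open>J\<close>, the action of \<open>r\<close> on the first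
  two positions becomes \<open>(c, b, a) \<mapsto> (b, b \<triangleright> c, a)\<close>, by the first component of the braid identity;
  its action on the last two becomes \<open>(c, b, a) \<mapsto> (c, a, a \<triangleright> b)\<close>, because each \<open>\<sigma>\<^sub>a\<close> is an
  endomorphism of \<open>\<triangleright>\<close> (lemma \<open>sigma_shelf_hom\<close>, from the first two components). The two sides of
  the braid identity then end in \<open>(a, a \<triangleright> b, a \<triangleright> (b \<triangleright> c))\<close> and
  \<open>(a, a \<triangleright> b, (a \<triangleright> b) \<triangleright> (a \<triangleright> c))\<close>. The proof of \<open>shelf_self_distrib\<close> is this computation, carried
  out on the third coordinate.
\<close>

locale left_nondegenerate_solution =
  fixes X :: "'a set" and r :: "'a \<times> 'a \<Rightarrow> 'a \<times> 'a"
  assumes solution: "solution X r"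
    and left_nondegenerate: "left_nondegenerate X r"
begin

abbreviation s where "s \<equiv> sigma r"
abbreviation t where "t \<equiv> tau r"
abbreviation shelf (infixr "\<triangleright>" 70) where "a \<triangleright> b \<equiv> shelf_op X r a b"

lemma r_closed: "a \<in> X \<Longrightarrow> b \<in> X \<Longrightarrow> r (a, b) \<in> X \<times> X"
  using solution unfolding solution_def by blast

lemma sigma_closed [simp]: "a \<in> X \<Longrightarrow> b \<in> X \<Longrightarrow> s a b \<in> X"
  using r_closed[of a b] by (auto simp: sigma_def mem_Times_iff)

lemma tau_closed [simp]: "a \<in> X \<Longrightarrow> b \<in> X \<Longrightarrow> t b a \<in> X"
  using r_closed[of a b] by (auto simp: tau_def mem_Times_iff)

lemma sigma_bij: "a \<in> X \<Longrightarrow> bij_betw (s a) X X"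
  using left_nondegenerate by (simp add: left_nondegenerate_def)

lemma sigma_surjE:
  assumes "a \<in> X" "b \<in> X"
  obtains c where "c \<in> X" "s a c = b"
proof -
  have "b \<in> s a ` X" using sigma_bij[OF assms(1)] assms(2) by (simp add: bij_betw_def)
  then show ?thesis using that by blast
qed

lemma braid_components:
  assumes "a \<in> X" "b \<in> X" "c \<in> X"
  shows sigma_braid: "s (s a b) (s (t b a) c) = s a (s b c)"
    and sigma_tau_braid: "t (s (t b a) c) (s a b) = s (t (s b c) a) (t c b)"
    and tau_braid: "t c (t b a) = t (t c b) (t (s b c) a)"
proof -
  have "(r_times_id r \<circ> id_times_r r \<circ> r_times_id r) (a, b, c) =
        (id_times_r r \<circ> r_times_id r \<circ> id_times_r r) (a, b, c)"
    using solution assms unfolding solution_def by blast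
  then show "s (s a b) (s (t b a) c) = s a (s b c)"
    and "t (s (t b a) c) (s a b) = s (t (s b c) a) (t c b)"
    and "t c (t b a) = t (t c b) (t (s b c) a)"
    by (simp_all add: r_times_id_def id_times_r_def sigma_def tau_def map_prod_def
        case_prod_unfold prod_eq_iff)
qed

text \<open>
  With the left argument written as \<open>\<sigma>\<^sub>b c\<close>, the inverse in the definition of \<open>\<triangleright>\<close> disappears;
  by surjectivity every left argument has this form, so all later computations use this shape.
\<close>

lemma shelf_sigma:
  assumes "b \<in> X" "c \<in> X"
  shows "s b c \<triangleright> b = s (s b c) (t c b)"
proof -
  have "inv_into X (s b) (s b c) = c"
    using sigma_bij[OF assms(1)] assms(2) by (simp add: bij_betw_def)
  then show ?thesis by (simp add: shelf_op_def)
qed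

lemma shelf_closed:
  assumes "a \<in> X" "b \<in> X"
  shows "a \<triangleright> b \<in> X"
proof -
  obtain c where "c \<in> X" "s b c = a" using sigma_surjE assms by metis
  then show ?thesis using shelf_sigma[of b c] assms by auto
qed

text \<open>
  For \<open>b = \<sigma>\<^sub>c d\<close>, the first component of the braid identity at \<open>(a, c, d)\<close> writes \<open>\<sigma>\<^sub>a b\<close> in the
  form required by \<open>shelf_sigma\<close>, and the second component identifies the resulting value of \<open>\<tau>\<close>.
\<close>

lemma sigma_shelf_hom:
  assumes "a \<in> X" "b \<in> X" "c \<in> X"
  shows "s a (b \<triangleright> c) = s a b \<triangleright> s a c"
proof -
  obtain d where d: "d \<in> X" "s c d = b" using sigma_surjE assms by metis
  have ab: "s (s a c) (s (t c a) d) = s a b"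
    using sigma_braid[of a c d] assms d by simp
  have "s a (b \<triangleright> c) = s a (s b (t d c))"
    using shelf_sigma[of c d] assms d by simp
  also have "\<dots> = s (s a b) (s (t b a) (t d c))"
    using sigma_braid[of a b "t d c"] assms d by simp
  also have "\<dots> = s (s a b) (t (s (t c a) d) (s a c))"
    using sigma_tau_braid[of a c d] assms d by simp
  also have "\<dots> = s a b \<triangleright> s a c"
    using shelf_sigma[of "s a c" "s (t c a) d"] ab assms d by simp
  finally show ?thesis .
qed

lemma shelf_self_distrib:
  assumes "a \<in> X" "b \<in> X" "c \<in> X"
  shows "a \<triangleright> (b \<triangleright> c) = (a \<triangleright> b) \<triangleright> (a \<triangleright> c)"
proof -
  \<comment> \<open>The triple \<open>(c, p, q)\<close> is the preimage of \<open>(c, b, a)\<close> under the bijection \<open>J\<close>.\<close>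
  obtain p where p: "p \<in> X" "s c p = b" using sigma_surjE assms by metis
  obtain k where k: "k \<in> X" "s c k = a" using sigma_surjE assms by metis
  obtain q where q: "q \<in> X" "s p q = k" using sigma_surjE p k by metis
  define u where "u = t p c"
  define v where "v = t k c"
  define w where "w = t q p"
  have X: "u \<in> X" "v \<in> X" "w \<in> X"
    using assms p k q by (auto simp: u_def v_def w_def)
  have a: "s b (s u q) = a"
    using sigma_braid[of c p q] assms p k q by (simp add: u_def)
  have bc: "b \<triangleright> c = s b u" using shelf_sigma[of c p] assms p by (simp add: u_def)
  have ac: "a \<triangleright> c = s a v" using shelf_sigma[of c k] assms k by (simp add: v_def)
  have kp: "k \<triangleright> p = s k w" using shelf_sigma[of p q] p q by (simp add: w_def)
  have "a \<triangleright> b = s c (s k w)"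
    using sigma_shelf_hom[of c k p] assms p k kp by simp
  also have "\<dots> = s a (s v w)"
    using sigma_braid[of c k w] assms k X by (simp add: v_def)
  finally have ab: "a \<triangleright> b = s a (s v w)" .
  have "a \<triangleright> (b \<triangleright> c) = s b (s u q \<triangleright> u)"
    using sigma_shelf_hom[of b "s u q" u] assms q X a bc by simp
  also have "\<dots> = s b (s (s u q) (t q u))"
    using shelf_sigma[of u q] q X by simp
  also have "\<dots> = s a (s (t (s u q) b) (t q u))"
    using sigma_braid[of b "s u q" "t q u"] assms q X a by simp
  also have "t (s u q) b = s v w"
    using sigma_tau_braid[of c p q] assms p q by (simp add: u_def v_def w_def)
  also have "t q u = t w v"
    using tau_braid[of c p q] assms p q by (simp add: u_def v_def w_def)
  also have "s a (s (s v w) (t w v)) = s a (s v w \<triangleright> v)"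
    using shelf_sigma[of v w] X by simp
  also have "\<dots> = (a \<triangleright> b) \<triangleright> (a \<triangleright> c)"
    using sigma_shelf_hom[of a "s v w" v] assms X ab ac by simp
  finally show ?thesis .
qed

end

theorem lemma3p4:
  fixes X :: "'a set" and r :: "'a \<times> 'a \<Rightarrow> 'a \<times> 'a" and x :: 'a
  assumes "solution X r"
    and "left_nondegenerate X r"
    and "x \<in> X"
  shows "yang_baxter_algebra X r
           (\<lambda>(a, b). shelf_op X r (sigma r a b) (shelf_op X r a x))"
proof -
  interpret left_nondegenerate_solution X r
    using assms(1,2) by unfold_locales
  have invariant: "shelf_op X r (sigma r a b) (shelf_op X r a x) =
      shelf_op X r (sigma r (sigma r a b) (tau r b a)) (shelf_op X r (sigma r a b) x)"
    if "a \<in> X" "b \<in> X" for a b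
    using shelf_self_distrib[of "sigma r a b" a x] shelf_sigma[of a b] that assms(3) by simp
  have r: "r (a, b) = (sigma r a b, tau r b a)" for a b
    by (simp add: sigma_def tau_def)
  show ?thesis
    unfolding yang_baxter_algebra_def
  proof (intro conjI ballI)
    show "(\<lambda>(a, b). shelf_op X r (sigma r a b) (shelf_op X r a x)) \<in> X \<times> X \<rightarrow> X"
      using assms(3) by (auto simp: shelf_closed)
  next
    fix a b assume "a \<in> X" "b \<in> X"
    from invariant[OF this]
    show "(\<lambda>(a, b). shelf_op X r (sigma r a b) (shelf_op X r a x)) (a, b) =
        (\<lambda>(a, b). shelf_op X r (sigma r a b) (shelf_op X r a x)) (r (a, b))"
      by (simp only: r prod.case)
  qed
qed

end
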